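(* Let $f$ be a real analytic map from a neighborhood of $a\in\mathbb R^2$ to $\mathbb C=\mathbb R^2$, with $a$ a regular critical point. Then the order $j$ of the critical value curve of $f$ at $f(a)$ (in its natural parametrization) is the first integer $n\ge1$ for which $L_n(a)\ne0$ (with $j=\infty$ if there is no such $n$), where, $J$ denoting the Jacobian determinant of $f$, $$L_1=\begin{vmatrix}\nabla f\\ \nabla J\end{vmatrix},\qquad L_k=\begin{vmatrix}\nabla L_{k-1}\\ \nabla J\end{vmatrix}\quad(k\ge2).$$
   Context: For a complex-valued smooth function $G$ on an open subset of $\mathbb R^2=\mathbb C$, $\nabla G=(G_z,G_{\bar z})=\big(\tfrac12(G_x-iG_y),\tfrac12(G_x+iG_y)\big)$; the vertical bars denote the $2\times2$ determinant with the indicated rows, and $J$ is regarded as a complex-valued function. The point $a$ is a regular critical point if $J(a)=0$ and $(J_x,J_y)(a)\neq(0,0)$. The natural parametrization of the critical set $\{J=0\}$ near $a$ is the curve $\Gamma$ with $\Gamma'(t)=(-J_y(\Gamma(t)),J_x(\Gamma(t)))$, $\Gamma(0)=a$; the critical value curve is $\Sigma(t)=f(\Gamma(t))$, and $j$ is the lowest exponent occurring in the Taylor expansion of $\Sigma(t)-\Sigma(0)$ at $t=0$ ($j=\infty$ if $\Sigma$ is constant). *)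

theory Defs
  imports "HOL-Analysis.Analysis" "HOL-Library.Extended_Nat"
begin

text \<open>The plane is the type \<^typ>\<open>complex\<close>, with coordinates \<open>x = Re z\<close> and \<open>y = Im z\<close>.\<close>

text \<open>
  Expansion at every point of \<open>U\<close> into a power series in the two real variables. Summation
  over \<open>\<nat> \<times> \<nat>\<close> is unordered, i.e. absolute. The series represents \<open>f\<close> on a full disc, also
  where that disc leaves \<open>U\<close>; this makes no difference for open \<open>U\<close>.
\<close>
definition real_analytic_on :: "(complex \<Rightarrow> complex) \<Rightarrow> complex set \<Rightarrow> bool"
    (infix "real'_analytic'_on" 50) where
  "f real_analytic_on U \<longleftrightarrow>
     (\<forall>p\<in>U. \<exists>(c :: nat \<Rightarrow> nat \<Rightarrow> complex) r. r > 0 \<and>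
        (\<forall>z\<in>ball p r.
           ((\<lambda>(m, n). c m n * of_real (Re z - Re p) ^ m * of_real (Im z - Im p) ^ n)
              has_sum f z) UNIV))"

definition partial_x :: "(complex \<Rightarrow> 'a::real_normed_vector) \<Rightarrow> complex \<Rightarrow> 'a" where
  "partial_x G z = vector_derivative (\<lambda>s::real. G (z + of_real s)) (at 0)"

definition partial_y :: "(complex \<Rightarrow> 'a::real_normed_vector) \<Rightarrow> complex \<Rightarrow> 'a" where
  "partial_y G z = vector_derivative (\<lambda>s::real. G (z + \<i> * of_real s)) (at 0)"

definition nabla :: "(complex \<Rightarrow> complex) \<Rightarrow> complex \<Rightarrow> complex \<times> complex" where
  "nabla G z = ((partial_x G z - \<i> * partial_y G z) / 2, (partial_x G z + \<i> * partial_y G z) / 2)"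

definition det_rows :: "complex \<times> complex \<Rightarrow> complex \<times> complex \<Rightarrow> complex" where
  "det_rows v w = fst v * snd w - snd v * fst w"

definition jacobian :: "(complex \<Rightarrow> complex) \<Rightarrow> complex \<Rightarrow> real" where
  "jacobian f z = Re (partial_x f z) * Im (partial_y f z) - Re (partial_y f z) * Im (partial_x f z)"

definition regular_critical_point :: "(complex \<Rightarrow> complex) \<Rightarrow> complex \<Rightarrow> bool" where
  "regular_critical_point f a \<longleftrightarrow>
     jacobian f a = 0 \<and> (partial_x (jacobian f) a, partial_y (jacobian f) a) \<noteq> (0, 0)"

text \<open>
  Starting the recursion at \<open>f\<close> itself, as \<open>L\<^sub>0\<close>, covers both \<open>L\<^sub>1\<close> (built from \<open>\<nabla>f\<close>) and the
  step from \<open>L\<^sub>k\<^sub>-\<^sub>1\<close> to \<open>L\<^sub>k\<close>.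
\<close>
primrec L :: "(complex \<Rightarrow> complex) \<Rightarrow> nat \<Rightarrow> complex \<Rightarrow> complex" where
  "L f 0 = f"
| "L f (Suc k) = (\<lambda>z. det_rows (nabla (L f k) z) (nabla (\<lambda>w. of_real (jacobian f w)) z))"

definition natural_parametrization ::
    "(complex \<Rightarrow> complex) \<Rightarrow> complex set \<Rightarrow> complex \<Rightarrow> real \<Rightarrow> (real \<Rightarrow> complex) \<Rightarrow> bool" where
  "natural_parametrization f U a \<epsilon> \<Gamma> \<longleftrightarrow>
     \<epsilon> > 0 \<and> \<Gamma> 0 = a \<and>
     (\<forall>t\<in>{-\<epsilon><..<\<epsilon>}. \<Gamma> t \<in> U \<and>
        (\<Gamma> has_vector_derivative
           Complex (- partial_y (jacobian f) (\<Gamma> t)) (partial_x (jacobian f) (\<Gamma> t))) (at t))"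

definition taylor_coeff :: "(real \<Rightarrow> complex) \<Rightarrow> nat \<Rightarrow> complex" where
  "taylor_coeff g n = ((\<lambda>h t. vector_derivative h (at t)) ^^ n) g 0 / fact n"

text \<open>
  Constancy is tested near \<open>0\<close>. For a non-constant curve that is flat at \<open>0\<close> the \<open>LEAST\<close> is an
  unspecified number; this cannot happen for an analytic curve.
\<close>
definition curve_order :: "(real \<Rightarrow> complex) \<Rightarrow> enat" where
  "curve_order \<Sigma> =
     (if \<forall>\<^sub>F t in nhds 0. \<Sigma> t = \<Sigma> 0 then \<infinity>
      else enat (LEAST n. taylor_coeff (\<lambda>t. \<Sigma> t - \<Sigma> 0) n \<noteq> 0))"

end

theory Submission
  imports Defs "HOL-Library.Nat_Bijection"
begin

text \<open>
  Along \<open>\<Gamma>\<close> one has \<open>(L\<^sub>k \<circ> \<Gamma>)' = 2\<i> (L\<^sub>k\<^sub>+\<^sub>1 \<circ> \<Gamma>)\<close>, so that the \<open>n\<close>-th derivative of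
  \<open>\<Sigma> = f \<circ> \<Gamma>\<close> is \<open>(2\<i>)\<^sup>n (L\<^sub>n \<circ> \<Gamma>)\<close>. What remains is that \<open>\<Sigma>\<close> is constant near \<open>0\<close> if all
  \<open>L\<^sub>n\<close> vanish at \<open>a\<close>. Instead of proving that \<open>\<Gamma>\<close> is analytic, one bounds the \<open>L\<^sub>n\<close> directly. For
  functions given by power series with \<open>\<Sum>|c\<^sub>m\<^sub>n| r\<^sup>m\<^sup>+\<^sup>n \<le> K\<close>, products multiply the bounds, and a
  partial derivative costs a factor \<open>1/\<delta>\<close> on passing from \<open>r\<close> to \<open>r - \<delta>\<close>. Spending the
  loss \<open>R/2\<close> in \<open>n\<close> equal steps gives \<open>|L\<^sub>n| \<le> K (C n)\<^sup>n\<close> on a fixed square around \<open>a\<close>. As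
  \<open>n\<^sup>n \<le> e\<^sup>n n!\<close>, the Taylor remainders of \<open>\<Sigma>\<close> tend to \<open>0\<close> near \<open>0\<close>.
\<close>

section \<open>Remainder estimates for monomials\<close>

text \<open>The left side consists of the first two terms of the binomial expansion. It also
  replaces Cauchy's estimate: it bounds the derivative \<open>real m * \<rho> ^ (m - 1)\<close> by
  \<open>(\<rho> + \<delta>) ^ m / \<delta>\<close>.\<close>

lemma power_first_order_bound:
  fixes \<rho> \<delta> :: real
  assumes "0 \<le> \<rho>" "0 \<le> \<delta>"
  shows "\<rho> ^ m + real m * \<rho> ^ (m - 1) * \<delta> \<le> (\<rho> + \<delta>) ^ m"
proof (induction m)
  case (Suc m)
  have "\<rho> ^ Suc m + real (Suc m) * \<rho> ^ (Suc m - 1) * \<delta>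
      = (\<rho> + \<delta>) * (\<rho> ^ m + real m * \<rho> ^ (m - 1) * \<delta>) - real m * \<rho> ^ (m - 1) * \<delta> * \<delta>"
    by (cases m) (simp_all add: algebra_simps)
  also have "\<dots> \<le> (\<rho> + \<delta>) * (\<rho> ^ m + real m * \<rho> ^ (m - 1) * \<delta>)"
    using assms by simp
  also have "\<dots> \<le> (\<rho> + \<delta>) ^ Suc m"
    using assms Suc by (simp add: mult_left_mono)
  finally show ?case .
qed simp

text \<open>The subtracted terms on the right are what makes the induction on \<open>m\<close> work.\<close>
lemma power_second_order_bound_aux:
  fixes x h \<rho> \<delta> e :: real
  assumes "\<bar>x\<bar> \<le> \<rho>" "\<bar>h\<bar> \<le> e * \<delta>" "0 \<le> e" "e \<le> 1" "0 \<le> \<delta>"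
  shows "\<bar>(x + h) ^ m - x ^ m - real m * x ^ (m - 1) * h\<bar>
    \<le> e\<^sup>2 * ((\<rho> + \<delta>) ^ m - \<rho> ^ m - real m * \<rho> ^ (m - 1) * \<delta>)"
proof (induction m)
  case (Suc m)
  let ?E = "(x + h) ^ m - x ^ m - real m * x ^ (m - 1) * h"
  let ?F = "(\<rho> + \<delta>) ^ m - \<rho> ^ m - real m * \<rho> ^ (m - 1) * \<delta>"
  have rho: "0 \<le> \<rho>" using assms(1) by linarith
  have F: "0 \<le> ?F"
    using power_first_order_bound[OF rho assms(5), of m] by simp
  \<comment> \<open>The remainder satisfies a recursion with source term
    \<open>real m * x ^ (m - 1) * h\<^sup>2\<close>. As \<open>?F\<close> is the same remainder at
    \<open>\<rho>\<close>, \<open>\<delta>\<close>, it satisfies the same recursion, and the two can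
    be compared term by term.\<close>
  have E_eq: "(x + h) ^ Suc m - x ^ Suc m - real (Suc m) * x ^ (Suc m - 1) * h
      = (x + h) * ?E + real m * x ^ (m - 1) * h\<^sup>2"
    by (cases m) (simp_all add: algebra_simps power2_eq_square)
  have F_eq: "(\<rho> + \<delta>) ^ Suc m - \<rho> ^ Suc m - real (Suc m) * \<rho> ^ (Suc m - 1) * \<delta>
      = (\<rho> + \<delta>) * ?F + real m * \<rho> ^ (m - 1) * \<delta>\<^sup>2"
    by (cases m) (simp_all add: algebra_simps power2_eq_square)
  have "e * \<delta> \<le> \<delta>"
    using assms by (simp add: mult_left_le_one_le)
  then have xh: "\<bar>x + h\<bar> \<le> \<rho> + \<delta>"
    using assms by linarith
  have 1: "\<bar>(x + h) * ?E\<bar> \<le> (\<rho> + \<delta>) * (e\<^sup>2 * ?F)"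
    unfolding abs_mult by (rule mult_mono[OF xh Suc]) (use rho assms in auto)
  have h2: "h\<^sup>2 \<le> e\<^sup>2 * \<delta>\<^sup>2"
    using power_mono[OF assms(2), of 2] by (simp add: power_mult_distrib)
  have "\<bar>x\<bar> ^ (m - 1) \<le> \<rho> ^ (m - 1)"
    using assms(1) by (intro power_mono) auto
  then have 2: "\<bar>real m * x ^ (m - 1) * h\<^sup>2\<bar> \<le> real m * \<rho> ^ (m - 1) * (e\<^sup>2 * \<delta>\<^sup>2)"
    unfolding abs_mult power_abs using h2 rho by (intro mult_mono) auto
  have "\<bar>(x + h) * ?E + real m * x ^ (m - 1) * h\<^sup>2\<bar>
      \<le> (\<rho> + \<delta>) * (e\<^sup>2 * ?F) + real m * \<rho> ^ (m - 1) * (e\<^sup>2 * \<delta>\<^sup>2)"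
    using 1 2 by linarith
  also have "\<dots> = e\<^sup>2 * ((\<rho> + \<delta>) * ?F + real m * \<rho> ^ (m - 1) * \<delta>\<^sup>2)"
    by (simp add: algebra_simps)
  finally show ?case
    unfolding E_eq F_eq .
qed simp

text \<open>Here \<open>e\<close> measures the increment relative to \<open>\<delta>\<close>. The
  bound is quadratic in \<open>e\<close> with a constant that does not involve \<open>e\<close>, so
  it can be summed against the coefficients of a series converging at radius
  \<open>\<rho> + \<delta>\<close>.\<close>

lemma power_second_order_bound:
  fixes x h \<rho> \<delta> e :: real
  assumes "\<bar>x\<bar> \<le> \<rho>" "\<bar>h\<bar> \<le> e * \<delta>" "0 \<le> e" "e \<le> 1" "0 \<le> \<delta>"
  shows "\<bar>(x + h) ^ m - x ^ m - real m * x ^ (m - 1) * h\<bar> \<le> e\<^sup>2 * (\<rho> + \<delta>) ^ m"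
proof -
  have "0 \<le> \<rho>" using assms(1) by linarith
  then have "0 \<le> \<rho> ^ m" "0 \<le> real m * \<rho> ^ (m - 1) * \<delta>"
    using assms by simp_all
  then have "(\<rho> + \<delta>) ^ m - \<rho> ^ m - real m * \<rho> ^ (m - 1) * \<delta> \<le> (\<rho> + \<delta>) ^ m"
    by linarith
  then have "e\<^sup>2 * ((\<rho> + \<delta>) ^ m - \<rho> ^ m - real m * \<rho> ^ (m - 1) * \<delta>) \<le> e\<^sup>2 * (\<rho> + \<delta>) ^ m"
    by (intro mult_left_mono) auto
  then show ?thesis
    using power_second_order_bound_aux[OF assms, of m] by linarith
qed

text \<open>The constant 3 counts three quadratic errors: the remainder of each factor and the
  product of the two linear parts.\<close>

lemma monomial_second_order_bound:
  fixes x y h k \<rho> \<delta> e :: real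
  assumes "\<bar>x\<bar> \<le> \<rho>" "\<bar>h\<bar> \<le> e * \<delta>" "\<bar>y\<bar> \<le> \<rho>" "\<bar>k\<bar> \<le> e * \<delta>" "0 \<le> e" "e \<le> 1" "0 \<le> \<delta>"
  shows "\<bar>(x + h) ^ m * (y + k) ^ n - x ^ m * y ^ n
           - (h * (real m * x ^ (m - 1) * y ^ n) + k * (real n * x ^ m * y ^ (n - 1)))\<bar>
    \<le> 3 * e\<^sup>2 * (\<rho> + \<delta>) ^ (m + n)"
proof -
  have rho: "0 \<le> \<rho>" using assms(1) by linarith
  have first: "\<bar>real j * u ^ (j - 1) * v\<bar> \<le> e * (\<rho> + \<delta>) ^ j"
    if "\<bar>u\<bar> \<le> \<rho>" "\<bar>v\<bar> \<le> e * \<delta>" for j and u v :: real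
  proof -
    have "\<bar>u\<bar> ^ (j - 1) \<le> \<rho> ^ (j - 1)"
      using that(1) by (intro power_mono) auto
    then have "\<bar>real j * u ^ (j - 1) * v\<bar> \<le> real j * \<rho> ^ (j - 1) * (e * \<delta>)"
      unfolding abs_mult power_abs using that(2) rho by (intro mult_mono) auto
    also have "\<dots> = e * (real j * \<rho> ^ (j - 1) * \<delta>)" by simp
    also have "\<dots> \<le> e * (\<rho> + \<delta>) ^ j"
      using power_first_order_bound[OF rho assms(7), of j] assms(5) zero_le_power[OF rho, of j]
      by (intro mult_left_mono) linarith+
    finally show ?thesis .
  qed
  have "e * \<delta> \<le> \<delta>"
    using assms by (simp add: mult_left_le_one_le)
  then have yk: "\<bar>y + k\<bar> \<le> \<rho> + \<delta>"
    using assms by linarith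
  define s where "s = \<rho> + \<delta>"
  have s: "0 \<le> s" using rho assms unfolding s_def by simp
  define A A1 dA B B1 dB where "A = x ^ m" "A1 = (x + h) ^ m" "dA = real m * x ^ (m - 1) * h"
    "B = y ^ n" "B1 = (y + k) ^ n" "dB = real n * y ^ (n - 1) * k"
  note defs = this
  have EA: "\<bar>A1 - A - dA\<bar> \<le> e\<^sup>2 * s ^ m" and EB: "\<bar>B1 - B - dB\<bar> \<le> e\<^sup>2 * s ^ n"
    using power_second_order_bound assms unfolding defs s_def by auto
  have dA: "\<bar>dA\<bar> \<le> e * s ^ m" and dB: "\<bar>dB\<bar> \<le> e * s ^ n"
    using first assms unfolding defs s_def by auto
  have B1: "\<bar>B1\<bar> \<le> s ^ n"
    using yk unfolding defs s_def power_abs by (auto intro: power_mono)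
  \<comment> \<open>Estimating the two summands by the first two binomial terms together avoids a
    factor 2.\<close>
  have AdA: "\<bar>A + dA\<bar> \<le> s ^ m"
  proof -
    have "\<bar>dA\<bar> \<le> real m * \<rho> ^ (m - 1) * \<delta>"
      unfolding defs abs_mult power_abs
      using assms(1,2) \<open>e * \<delta> \<le> \<delta>\<close> rho by (intro mult_mono power_mono) auto
    moreover have "\<bar>A\<bar> \<le> \<rho> ^ m"
      using assms(1) unfolding defs power_abs by (auto intro: power_mono)
    ultimately show ?thesis
      using power_first_order_bound[OF rho assms(7), of m] unfolding s_def by linarith
  qed
  have "\<bar>(A1 - A - dA) * B1\<bar> \<le> e\<^sup>2 * s ^ m * s ^ n"
    unfolding abs_mult using EA B1 s by (intro mult_mono) auto
  moreover have "\<bar>(A + dA) * (B1 - B - dB)\<bar> \<le> s ^ m * (e\<^sup>2 * s ^ n)"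
    unfolding abs_mult using EB AdA s by (intro mult_mono) auto
  moreover have "\<bar>dA * dB\<bar> \<le> e * s ^ m * (e * s ^ n)"
    unfolding abs_mult using dA dB s assms(5) by (intro mult_mono) auto
  moreover have "A1 * B1 - A * B - (dA * B + A * dB)
      = (A1 - A - dA) * B1 + (A + dA) * (B1 - B - dB) + dA * dB"
    by (simp add: algebra_simps)
  ultimately have "\<bar>A1 * B1 - A * B - (dA * B + A * dB)\<bar>
      \<le> e\<^sup>2 * s ^ m * s ^ n + s ^ m * (e\<^sup>2 * s ^ n) + e * s ^ m * (e * s ^ n)"
    by linarith
  also have "\<dots> = 3 * e\<^sup>2 * s ^ (m + n)"
    by (simp add: power_add power2_eq_square algebra_simps)
  finally show ?thesis
    unfolding defs s_def by (simp add: algebra_simps)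
qed

section \<open>Majorized power series in two real variables\<close>

text \<open>A closed square fits two real variables: for nonnegative \<open>r\<close> every monomial
  attains its bound \<open>r ^ (m + n)\<close> at a corner.\<close>

definition sq_nbhd :: "complex \<Rightarrow> real \<Rightarrow> complex set" where
  "sq_nbhd a r = {z. \<bar>Re z - Re a\<bar> \<le> r \<and> \<bar>Im z - Im a\<bar> \<le> r}"

text \<open>
  The series is a list of monomials in which exponents may repeat, so products and derivatives
  need no collecting of terms.
\<close>
definition expansion :: "complex \<Rightarrow> real \<Rightarrow> (nat \<Rightarrow> complex) \<Rightarrow> (nat \<Rightarrow> nat) \<Rightarrow> (nat \<Rightarrow> nat) \<Rightarrow> real
    \<Rightarrow> (complex \<Rightarrow> complex) \<Rightarrow> bool" where
  "expansion a r c m n S G \<longleftrightarrow>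
     ((\<lambda>i. norm (c i) * r ^ (m i + n i)) has_sum S) UNIV \<and>
     (\<forall>z\<in>sq_nbhd a r.
        ((\<lambda>i. c i * of_real (Re z - Re a) ^ m i * of_real (Im z - Im a) ^ n i) has_sum G z) UNIV)"

lemma expansionI:
  assumes "((\<lambda>i. norm (c i) * r ^ (m i + n i)) has_sum S) UNIV"
    and "\<And>z. z \<in> sq_nbhd a r \<Longrightarrow>
      ((\<lambda>i. c i * of_real (Re z - Re a) ^ m i * of_real (Im z - Im a) ^ n i) has_sum G z) UNIV"
  shows "expansion a r c m n S G"
  using assms unfolding expansion_def by blast

lemma expansionD:
  assumes "expansion a r c m n S G"
  shows "((\<lambda>i. norm (c i) * r ^ (m i + n i)) has_sum S) UNIV"
    and "z \<in> sq_nbhd a r \<Longrightarrow>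
      ((\<lambda>i. c i * of_real (Re z - Re a) ^ m i * of_real (Im z - Im a) ^ n i) has_sum G z) UNIV"
  using assms unfolding expansion_def by blast+

text \<open>A bound on a weighted l1 norm of the coefficients. Unlike a supremum bound on the real
  square, it controls partial derivatives on smaller squares.\<close>

definition majorized :: "complex \<Rightarrow> real \<Rightarrow> real \<Rightarrow> (complex \<Rightarrow> complex) \<Rightarrow> bool" where
  "majorized a r K G \<longleftrightarrow> (\<exists>c m n S. expansion a r c m n S G \<and> S \<le> K)"

lemma majorizedI: "expansion a r c m n S G \<Longrightarrow> S \<le> K \<Longrightarrow> majorized a r K G"
  unfolding majorized_def by blast

lemma majorizedE:
  assumes "majorized a r K G"
  obtains c m n S where "expansion a r c m n S G" "S \<le> K"
  using assms unfolding majorized_def by blast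

lemma norm_monomial_le:
  assumes "z \<in> sq_nbhd a r"
  shows "norm (c * of_real (Re z - Re a) ^ m * of_real (Im z - Im a) ^ n :: complex)
    \<le> norm c * r ^ (m + n)"
proof -
  have "\<bar>Re z - Re a\<bar> ^ m * \<bar>Im z - Im a\<bar> ^ n \<le> r ^ m * r ^ n"
    using assms unfolding sq_nbhd_def by (intro mult_mono power_mono) auto
  then show ?thesis
    by (simp add: norm_mult norm_power power_add mult.assoc mult_left_mono flip: of_real_diff)
qed

lemma majorized_bound:
  assumes "majorized a r K G" "z \<in> sq_nbhd a r"
  shows "norm (G z) \<le> K"
  using assms(1)
proof (rule majorizedE)
  fix c m n S
  assume G: "expansion a r c m n S G" and S: "S \<le> K"
  note * = expansionD[OF G]
  have "norm (G z) \<le> S"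
    by (rule norm_infsum_le[OF *(2)[OF assms(2)] *(1)]) (rule norm_monomial_le[OF assms(2)])
  then show ?thesis using S by simp
qed

lemma majorized_cong:
  assumes "majorized a r K G" "\<And>z. z \<in> sq_nbhd a r \<Longrightarrow> G z = H z"
  shows "majorized a r K H"
proof -
  obtain c m n S where G: "expansion a r c m n S G" and S: "S \<le> K"
    using assms(1) by (rule majorizedE)
  have "expansion a r c m n S H"
    using expansionD[OF G] assms(2) by (intro expansionI) simp_all
  then show ?thesis
    using S by (rule majorizedI)
qed

text \<open>Serves for series dominated termwise by a known one, as when the radius shrinks or a
  series is differentiated formally. The second conclusion retains the coefficients, which
  \<open>majorized\<close> hides.\<close>

lemma majorized_by_sumI:
  fixes c :: "nat \<Rightarrow> complex" and a :: complex
  assumes g: "(g has_sum T) UNIV" "T \<le> K"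
    and le: "\<And>i. norm (c i) * r ^ (m i + n i) \<le> g i" and r: "0 \<le> r"
    and G: "\<And>z. z \<in> sq_nbhd a r \<Longrightarrow>
      G z = (\<Sum>\<^sub>\<infinity>i. c i * of_real (Re z - Re a) ^ m i * of_real (Im z - Im a) ^ n i)"
  shows "majorized a r K G"
    and "\<And>z. z \<in> sq_nbhd a r \<Longrightarrow>
      ((\<lambda>i. c i * of_real (Re z - Re a) ^ m i * of_real (Im z - Im a) ^ n i) has_sum G z) UNIV"
proof -
  have sm: "(\<lambda>i. norm (c i) * r ^ (m i + n i)) summable_on UNIV"
    by (rule summable_on_comparison_test[OF has_sum_imp_summable[OF g(1)]]) (use le r in auto)
  then obtain S where S: "((\<lambda>i. norm (c i) * r ^ (m i + n i)) has_sum S) UNIV"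
    by (auto simp: summable_on_def)
  have "S \<le> T"
    by (rule has_sum_mono[OF S g(1)]) (use le in auto)
  show *: "((\<lambda>i. c i * of_real (Re z - Re a) ^ m i * of_real (Im z - Im a) ^ n i) has_sum G z) UNIV"
    if "z \<in> sq_nbhd a r" for z
  proof -
    have "(\<lambda>i. norm (c i * of_real (Re z - Re a) ^ m i * of_real (Im z - Im a) ^ n i)) summable_on UNIV"
      by (rule Infinite_Sum.abs_summable_on_comparison_test'[OF sm]) (rule norm_monomial_le[OF that])
    then show ?thesis
      unfolding G[OF that] by (rule has_sum_infsum[OF Infinite_Sum.abs_summable_summable])
  qed
  show "majorized a r K G"
    by (rule majorizedI[OF expansionI[OF S *]]) (use \<open>S \<le> T\<close> \<open>T \<le> K\<close> in auto)
qed

lemma sq_nbhd_mono: "r' \<le> r \<Longrightarrow> sq_nbhd a r' \<subseteq> sq_nbhd a r"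
  unfolding sq_nbhd_def by auto

lemma majorized_mono:
  assumes "majorized a r K G" "r' \<le> r" "0 \<le> r'" "K \<le> K'"
  shows "majorized a r' K' G"
  using assms(1)
proof (rule majorizedE)
  fix c m n S
  assume G: "expansion a r c m n S G" and S: "S \<le> K"
  note * = expansionD[OF G]
  have le: "norm (c i) * r' ^ (m i + n i) \<le> norm (c i) * r ^ (m i + n i)" for i
    using assms by (intro mult_left_mono power_mono) auto
  have "S \<le> K'" using S assms(4) by simp
  show ?thesis
  proof (rule majorized_by_sumI(1)[OF *(1) \<open>S \<le> K'\<close> le assms(3)])
    fix z assume "z \<in> sq_nbhd a r'"
    then have "z \<in> sq_nbhd a r" using sq_nbhd_mono[OF assms(2)] by blast
    from infsumI[OF *(2)[OF this]]
    show "G z = (\<Sum>\<^sub>\<infinity>i. c i * of_real (Re z - Re a) ^ m i * of_real (Im z - Im a) ^ n i)" ..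
  qed
qed

section \<open>Algebraic operations on majorized functions\<close>

lemma majorized_cnj:
  assumes "majorized a r K G"
  shows "majorized a r K (\<lambda>z. cnj (G z))"
  using assms
proof (rule majorizedE)
  fix c m n S
  assume G: "expansion a r c m n S G" and S: "S \<le> K"
  note * = expansionD[OF G]
  have "expansion a r (\<lambda>i. cnj (c i)) m n S (\<lambda>z. cnj (G z))"
  proof (rule expansionI)
    show "((\<lambda>i. norm (cnj (c i)) * r ^ (m i + n i)) has_sum S) UNIV"
      using *(1) by simp
    fix z assume "z \<in> sq_nbhd a r"
    from iffD2[OF has_sum_cnj_iff *(2)[OF this]]
    show "((\<lambda>i. cnj (c i) * of_real (Re z - Re a) ^ m i * of_real (Im z - Im a) ^ n i)
        has_sum cnj (G z)) UNIV"
      by simp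
  qed
  then show ?thesis
    using S by (rule majorizedI)
qed

lemma majorized_cmult:
  assumes "majorized a r K G"
  shows "majorized a r (norm k * K) (\<lambda>z. k * G z)"
  using assms
proof (rule majorizedE)
  fix c m n S
  assume G: "expansion a r c m n S G" and S: "S \<le> K"
  note * = expansionD[OF G]
  have "expansion a r (\<lambda>i. k * c i) m n (norm k * S) (\<lambda>z. k * G z)"
  proof (rule expansionI)
    show "((\<lambda>i. norm (k * c i) * r ^ (m i + n i)) has_sum norm k * S) UNIV"
      using has_sum_cmult_right[OF *(1), of "norm k"] by (simp add: norm_mult mult.assoc)
    fix z assume "z \<in> sq_nbhd a r"
    from has_sum_cmult_right[OF *(2)[OF this], of k]
    show "((\<lambda>i. k * c i * of_real (Re z - Re a) ^ m i * of_real (Im z - Im a) ^ n i)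
        has_sum k * G z) UNIV"
      by (simp add: mult.assoc)
  qed
  then show ?thesis
    by (rule majorizedI) (use S in \<open>simp add: mult_left_mono\<close>)
qed

text \<open>The sum of two series is the concatenation of their lists of monomials;
  \<open>sum_decode\<close> brings the disjoint union of index sets back to
  \<open>nat\<close>.\<close>

lemma has_sum_nat_interleave:
  fixes u v :: "nat \<Rightarrow> 'a :: {topological_comm_monoid_add, t3_space}"
  assumes "(u has_sum A) UNIV" "(v has_sum B) UNIV"
  shows "((\<lambda>i. case_sum u v (sum_decode i)) has_sum (A + B)) UNIV"
proof -
  have "(case_sum u v has_sum A) (range Inl)" "(case_sum u v has_sum B) (range Inr)"
    using assms by (subst has_sum_reindex, auto simp: o_def)+
  from has_sum_Un_disjoint[OF this]
  have "(case_sum u v has_sum (A + B)) (range Inl \<union> range Inr)" by auto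
  also have "range Inl \<union> range Inr = (UNIV :: (nat + nat) set)"
    by (simp add: UNIV_sum)
  finally show ?thesis
    by (rule iffD2[OF has_sum_reindex_bij_betw[OF bij_sum_decode]])
qed

lemma majorized_add:
  assumes "majorized a r K G" "majorized a r K' H"
  shows "majorized a r (K + K') (\<lambda>z. G z + H z)"
proof -
  obtain c m n S where G: "expansion a r c m n S G" and S: "S \<le> K"
    using assms(1) by (rule majorizedE)
  note * = expansionD[OF G]
  obtain c' m' n' S' where H: "expansion a r c' m' n' S' H" and S': "S' \<le> K'"
    using assms(2) by (rule majorizedE)
  note ** = expansionD[OF H]
  have "expansion a r (\<lambda>i. case_sum c c' (sum_decode i)) (\<lambda>i. case_sum m m' (sum_decode i))
    (\<lambda>i. case_sum n n' (sum_decode i)) (S + S') (\<lambda>z. G z + H z)"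
  proof (rule expansionI)
    show "((\<lambda>i. norm (case_sum c c' (sum_decode i)) *
         r ^ (case_sum m m' (sum_decode i) + case_sum n n' (sum_decode i))) has_sum S + S') UNIV"
      using has_sum_nat_interleave[OF *(1) **(1)]
      by (rule iffD1[OF has_sum_cong, rotated]) (simp split: sum.split)
    fix z assume "z \<in> sq_nbhd a r"
    from has_sum_nat_interleave[OF *(2)[OF this] **(2)[OF this]]
    show "((\<lambda>i. case_sum c c' (sum_decode i) *
          of_real (Re z - Re a) ^ case_sum m m' (sum_decode i) *
          of_real (Im z - Im a) ^ case_sum n n' (sum_decode i)) has_sum G z + H z) UNIV"
      by (rule iffD1[OF has_sum_cong, rotated]) (simp split: sum.split)
  qed
  then show ?thesis
    by (rule majorizedI) (simp add: add_mono S S')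
qed

lemma majorized_diff:
  assumes "majorized a r K G" "majorized a r K' H"
  shows "majorized a r (K + K') (\<lambda>z. G z - H z)"
  using majorized_add[OF assms(1) majorized_cmult[OF assms(2), of "-1"]] by simp

text \<open>Unordered summability of complex families is already absolute, so the family of products
  is summable and can be summed row by row.\<close>

lemma has_sum_nat_product:
  fixes u v :: "nat \<Rightarrow> complex"
  assumes u: "(u has_sum A) UNIV" and v: "(v has_sum B) UNIV"
  shows "((\<lambda>i. case prod_decode i of (j, k) \<Rightarrow> u j * v k) has_sum (A * B)) UNIV"
proof -
  have "(\<lambda>j. norm (u j)) summable_on UNIV" "(\<lambda>j. norm (v j)) summable_on UNIV"
    using has_sum_imp_summable[OF u] has_sum_imp_summable[OF v]
    by (simp_all flip: summable_on_iff_abs_summable_on_complex)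
  then obtain S T where S: "((\<lambda>j. norm (u j)) has_sum S) UNIV" and T: "((\<lambda>j. norm (v j)) has_sum T) UNIV"
    by (auto simp: summable_on_def)
  have "(\<lambda>p. norm (u (fst p) * v (snd p))) summable_on UNIV \<times> UNIV"
    by (rule summable_on_SigmaI[where g = "\<lambda>j. norm (u j) * T"])
      (auto simp: norm_mult intro!: has_sum_cmult_right T summable_on_cmult_left has_sum_imp_summable[OF S])
  then have sm: "(\<lambda>p. u (fst p) * v (snd p)) summable_on UNIV \<times> UNIV"
    by (rule Infinite_Sum.abs_summable_summable)
  have "((\<lambda>p. u (fst p) * v (snd p)) has_sum A * B) (UNIV \<times> UNIV)"
    by (rule has_sum_SigmaI[where g = "\<lambda>j. u j * B", OF _ _ sm])
      (simp_all add: has_sum_cmult_right[OF v] has_sum_cmult_left[OF u])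
  then show ?thesis
    using has_sum_reindex_bij_betw[OF bij_prod_decode, of "\<lambda>p. u (fst p) * v (snd p)" "A * B"]
    by (simp add: case_prod_beta)
qed

lemma majorized_mult:
  assumes "majorized a r K G" "majorized a r K' H" "0 \<le> r"
  shows "majorized a r (K * K') (\<lambda>z. G z * H z)"
proof -
  obtain c m n S where G: "expansion a r c m n S G" and S: "S \<le> K"
    using assms(1) by (rule majorizedE)
  note * = expansionD[OF G]
  obtain c' m' n' S' where H: "expansion a r c' m' n' S' H" and S': "S' \<le> K'"
    using assms(2) by (rule majorizedE)
  note ** = expansionD[OF H]
  have nonneg: "0 \<le> S" "0 \<le> S'"
    using assms(3) by (auto intro: has_sum_nonneg[OF *(1)] has_sum_nonneg[OF **(1)])
  define C M N where "C = (\<lambda>i. case prod_decode i of (j, k) \<Rightarrow> c j * c' k)"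
    "M = (\<lambda>i. case prod_decode i of (j, k) \<Rightarrow> m j + m' k)"
    "N = (\<lambda>i. case prod_decode i of (j, k) \<Rightarrow> n j + n' k)"
  note defs = this
  have "expansion a r C M N (S * S') (\<lambda>z. G z * H z)"
  proof (rule expansionI)
    \<comment> \<open>The weights are cast to complex numbers so that
      \<open>has_sum_nat_product\<close> applies to them too.\<close>
    have "((\<lambda>i. complex_of_real (norm (c i) * r ^ (m i + n i))) has_sum of_real S) UNIV"
      "((\<lambda>i. complex_of_real (norm (c' i) * r ^ (m' i + n' i))) has_sum of_real S') UNIV"
      using *(1) **(1) by (simp_all only: has_sum_of_real_iff)
    from has_sum_nat_product[OF this]
    have "((\<lambda>i. complex_of_real (norm (C i) * r ^ (M i + N i))) has_sum of_real (S * S')) UNIV"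
      unfolding defs by (simp add: case_prod_beta norm_mult power_add algebra_simps)
    then show "((\<lambda>i. norm (C i) * r ^ (M i + N i)) has_sum S * S') UNIV"
      by (simp only: has_sum_of_real_iff)
    fix z assume "z \<in> sq_nbhd a r"
    from has_sum_nat_product[OF *(2)[OF this] **(2)[OF this]]
    show "((\<lambda>i. C i * of_real (Re z - Re a) ^ M i * of_real (Im z - Im a) ^ N i)
        has_sum G z * H z) UNIV"
      unfolding defs by (simp add: case_prod_beta power_add algebra_simps)
  qed
  moreover have "S * S' \<le> K * K'"
    using S S' nonneg by (intro mult_mono) auto
  ultimately show ?thesis
    by (rule majorizedI)
qed

section \<open>Differentiation of majorized series\<close>

lemma partial_derivatives_of_has_derivative:
  fixes G :: "complex \<Rightarrow> 'a :: real_normed_vector"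
  assumes "(G has_derivative (\<lambda>h. Re h *\<^sub>R gx + Im h *\<^sub>R gy)) (at z)"
  shows "partial_x G z = gx" "partial_y G z = gy"
proof -
  have line: "((\<lambda>s::real. z + v * of_real s) has_vector_derivative v) (at 0)" for v
    by (auto intro!: derivative_eq_intros simp: has_vector_derivative_def scaleR_conv_of_real)
  have G: "(G has_derivative (\<lambda>h. Re h *\<^sub>R gx + Im h *\<^sub>R gy)) (at (z + v * of_real (0::real)))" for v
    using assms by simp
  have "((\<lambda>s. G (z + v * of_real s)) has_vector_derivative (Re v *\<^sub>R gx + Im v *\<^sub>R gy)) (at (0::real))" for v
    using vector_derivative_diff_chain_within[OF line has_derivative_at_withinI[OF G], of v]
    by (simp add: o_def)
  from vector_derivative_at[OF this[of 1]] vector_derivative_at[OF this[of "\<i>"]]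
  show "partial_x G z = gx" "partial_y G z = gy"
    by (simp_all add: partial_x_def partial_y_def)
qed

lemma has_sum_minus:
  fixes f g :: "'b \<Rightarrow> 'a :: real_normed_vector"
  assumes "(f has_sum x) A" "(g has_sum y) A"
  shows "((\<lambda>i. f i - g i) has_sum (x - y)) A"
  using has_sum_add[OF assms(1), of "\<lambda>i. - g i" "- y"] assms(2) by (simp add: has_sum_uminus)

text \<open>Termwise differentiation: the quadratic remainders of the monomials are summed against
  the coefficients. A ball of radius \<open>\<delta>\<close> around a point of the smaller square
  stays inside the larger one, so the derivative is two-sided even at boundary points.\<close>

lemma majorized_has_partials:
  assumes "majorized a r K G" "0 < \<delta>" "\<delta> \<le> r"
  obtains Gx Gy where "majorized a (r - \<delta>) (K / \<delta>) Gx" "majorized a (r - \<delta>) (K / \<delta>) Gy"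
    and "\<And>z. z \<in> sq_nbhd a (r - \<delta>) \<Longrightarrow>
      (G has_derivative (\<lambda>h. Re h *\<^sub>R Gx z + Im h *\<^sub>R Gy z)) (at z)"
proof -
  obtain c m n S where G: "expansion a r c m n S G" and S: "S \<le> K"
    using assms(1) by (rule majorizedE)
  define \<rho> where "\<rho> = r - \<delta>"
  have rho: "0 \<le> \<rho>" "\<rho> \<le> r" "\<rho> + \<delta> = r"
    using assms unfolding \<rho>_def by auto
  have sum: "((\<lambda>i. norm (c i) * r ^ (m i + n i) / \<delta>) has_sum S / \<delta>) UNIV"
    using has_sum_cmult_left[OF expansionD(1)[OF G], of "1 / \<delta>"] by simp
  have SK: "S / \<delta> \<le> K / \<delta>"
    using S assms(2) by (simp add: divide_right_mono)
  \<comment> \<open>This is the source of the factor \<open>1 / \<delta>\<close>.\<close>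
  have le: "real k * \<rho> ^ (k - 1) * \<rho> ^ l \<le> r ^ (k + l) / \<delta>" for k l
  proof -
    have "real k * \<rho> ^ (k - 1) * \<delta> \<le> r ^ k"
      using power_first_order_bound[OF rho(1), of \<delta> k] zero_le_power[OF rho(1), of k] assms(2) rho(3)
      by simp
    then have "real k * \<rho> ^ (k - 1) * \<delta> * \<rho> ^ l \<le> r ^ k * r ^ l"
      using rho by (intro mult_mono power_mono) auto
    then show ?thesis
      using assms(2) by (simp add: field_simps power_add)
  qed
  have lex: "norm (c i * of_nat (m i)) * \<rho> ^ (m i - 1 + n i) \<le> norm (c i) * r ^ (m i + n i) / \<delta>" for i
    using mult_left_mono[OF le[of "m i" "n i"], of "norm (c i)"]
    by (simp add: norm_mult power_add mult.assoc)
  have ley: "norm (c i * of_nat (n i)) * \<rho> ^ (m i + (n i - 1)) \<le> norm (c i) * r ^ (m i + n i) / \<delta>" for i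
    using mult_left_mono[OF le[of "n i" "m i"], of "norm (c i)"]
    by (simp add: norm_mult power_add ac_simps)
  \<comment> \<open>If \<open>m i = 0\<close>, the truncated exponent \<open>m i - 1\<close> is
    harmless because the coefficient \<open>of_nat (m i)\<close> vanishes; likewise for
    \<open>Gy\<close>.\<close>
  define Gx where "Gx = (\<lambda>z. \<Sum>\<^sub>\<infinity>i. c i * of_nat (m i) * of_real (Re z - Re a) ^ (m i - 1)
      * of_real (Im z - Im a) ^ n i)"
  define Gy where "Gy = (\<lambda>z. \<Sum>\<^sub>\<infinity>i. c i * of_nat (n i) * of_real (Re z - Re a) ^ m i
      * of_real (Im z - Im a) ^ (n i - 1))"
  note X = majorized_by_sumI[OF sum SK lex rho(1), where a = a and G = Gx, OF fun_cong[OF Gx_def]]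
  note Y = majorized_by_sumI[OF sum SK ley rho(1), where a = a and G = Gy, OF fun_cong[OF Gy_def]]
  have "(G has_derivative (\<lambda>h. Re h *\<^sub>R Gx z + Im h *\<^sub>R Gy z)) (at z)"
    if z: "z \<in> sq_nbhd a \<rho>" for z
  proof (rule has_derivativeI_sandwich)
    show "0 < \<delta>" by fact
    show "bounded_linear (\<lambda>h. Re h *\<^sub>R Gx z + Im h *\<^sub>R Gy z)"
      by (intro bounded_linear_add bounded_linear_scaleR_const bounded_linear_Re bounded_linear_Im)
    have zr: "z \<in> sq_nbhd a r" using z sq_nbhd_mono[OF rho(2)] by blast
    fix w assume w: "w \<noteq> z" "dist w z < \<delta>"
    define h where "h = w - z"
    \<comment> \<open>With this choice \<open>e\<^sup>2 / norm h\<close> equals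
      \<open>norm h / \<delta>\<^sup>2\<close>, so the difference quotient of the remainder tends to
      0.\<close>
    define e where "e = norm h / \<delta>"
    have h: "h \<noteq> 0" "norm h < \<delta>" "w = z + h"
      using w by (auto simp: h_def dist_norm)
    have e: "0 \<le> e" "e \<le> 1" "\<bar>Re h\<bar> \<le> e * \<delta>" "\<bar>Im h\<bar> \<le> e * \<delta>"
      using h(2) assms(2) by (auto simp: e_def abs_Re_le_cmod abs_Im_le_cmod)
    define x y where "x = Re z - Re a" "y = Im z - Im a"
    have xy: "\<bar>x\<bar> \<le> \<rho>" "\<bar>y\<bar> \<le> \<rho>"
      using z unfolding x_y_def sq_nbhd_def by auto
    have wr: "w \<in> sq_nbhd a r"
      using xy abs_Re_le_cmod[of h] abs_Im_le_cmod[of h] h rho unfolding x_y_def sq_nbhd_def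
      by (simp, intro conjI) linarith+
    let ?R = "\<lambda>i. (x + Re h) ^ m i * (y + Im h) ^ n i - x ^ m i * y ^ n i
       - (Re h * (real (m i) * x ^ (m i - 1) * y ^ n i) + Im h * (real (n i) * x ^ m i * y ^ (n i - 1)))"
    have eq: "Re w - Re a = x + Re h" "Im w - Im a = y + Im h" "Re z - Re a = x" "Im z - Im a = y"
      by (simp_all add: h(3) x_y_def)
    have "((\<lambda>i. c i * of_real (x + Re h) ^ m i * of_real (y + Im h) ^ n i - c i * of_real x ^ m i * of_real y ^ n i
       - (of_real (Re h) * (c i * of_nat (m i) * of_real x ^ (m i - 1) * of_real y ^ n i)
          + of_real (Im h) * (c i * of_nat (n i) * of_real x ^ m i * of_real y ^ (n i - 1))))
       has_sum (G w - G z - (of_real (Re h) * Gx z + of_real (Im h) * Gy z))) UNIV"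
      using expansionD(2)[OF G wr] expansionD(2)[OF G zr] X(2)[OF z] Y(2)[OF z]
      unfolding eq by (intro has_sum_minus has_sum_add has_sum_cmult_right)
    then have main: "((\<lambda>i. c i * of_real (?R i)) has_sum
        (G w - G z - (of_real (Re h) * Gx z + of_real (Im h) * Gy z))) UNIV"
      by (rule iffD1[OF has_sum_cong, rotated]) (simp add: algebra_simps)
    have sumR: "((\<lambda>i. 3 * e\<^sup>2 * (norm (c i) * r ^ (m i + n i))) has_sum 3 * e\<^sup>2 * S) UNIV"
      by (intro has_sum_cmult_right expansionD(1)[OF G])
    have "norm (c i * of_real (?R i)) \<le> 3 * e\<^sup>2 * (norm (c i) * r ^ (m i + n i))" for i
    proof -
      have "\<bar>?R i\<bar> \<le> 3 * e\<^sup>2 * (\<rho> + \<delta>) ^ (m i + n i)"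
        using xy e assms(2) by (intro monomial_second_order_bound) auto
      from mult_left_mono[OF this, of "norm (c i)"] show ?thesis
        unfolding norm_mult norm_of_real rho(3) by (simp add: ac_simps)
    qed
    from norm_infsum_le[OF main sumR this]
    have "norm (G w - G z - (of_real (Re h) * Gx z + of_real (Im h) * Gy z)) \<le> 3 * e\<^sup>2 * S" .
    then have "norm (G w - G z - (Re h *\<^sub>R Gx z + Im h *\<^sub>R Gy z)) / norm h \<le> 3 * e\<^sup>2 * S / norm h"
      by (simp add: divide_right_mono scaleR_conv_of_real)
    also have "\<dots> = 3 * S / \<delta>\<^sup>2 * norm (w - z)"
      using h(1) by (simp add: e_def power2_eq_square power_divide field_simps flip: h_def)
    finally show "norm (G w - G z - (Re (w - z) *\<^sub>R Gx z + Im (w - z) *\<^sub>R Gy z)) / norm (w - z)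
        \<le> 3 * S / \<delta>\<^sup>2 * norm (w - z)"
      unfolding h_def .
  next
    show "((\<lambda>w. 3 * S / \<delta>\<^sup>2 * norm (w - z)) \<longlongrightarrow> 0) (at z)"
      using assms(2) by (auto intro!: tendsto_eq_intros)
  qed
  then show thesis
    using that X(1) Y(1) unfolding \<rho>_def by blast
qed

lemma majorized_partials:
  assumes "majorized a r K G" "0 < \<delta>" "\<delta> \<le> r"
  shows "majorized a (r - \<delta>) (K / \<delta>) (partial_x G)" "majorized a (r - \<delta>) (K / \<delta>) (partial_y G)"
    and "\<And>z. z \<in> sq_nbhd a (r - \<delta>) \<Longrightarrow>
      (G has_derivative (\<lambda>h. Re h *\<^sub>R partial_x G z + Im h *\<^sub>R partial_y G z)) (at z)"
proof -
  obtain Gx Gy where *: "majorized a (r - \<delta>) (K / \<delta>) Gx" "majorized a (r - \<delta>) (K / \<delta>) Gy"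
    and D: "\<And>z. z \<in> sq_nbhd a (r - \<delta>) \<Longrightarrow>
      (G has_derivative (\<lambda>h. Re h *\<^sub>R Gx z + Im h *\<^sub>R Gy z)) (at z)"
    using majorized_has_partials[OF assms] by metis
  note eq = partial_derivatives_of_has_derivative[OF D]
  show "majorized a (r - \<delta>) (K / \<delta>) (partial_x G)"
    by (rule majorized_cong[OF *(1)]) (simp add: eq(1))
  show "majorized a (r - \<delta>) (K / \<delta>) (partial_y G)"
    by (rule majorized_cong[OF *(2)]) (simp add: eq(2))
  show "(G has_derivative (\<lambda>h. Re h *\<^sub>R partial_x G z + Im h *\<^sub>R partial_y G z)) (at z)"
    if "z \<in> sq_nbhd a (r - \<delta>)" for z
    using D[OF that] eq[OF that] by simp
qed

text \<open>Convergence at one corner of a square inside the disc is absolute, and there the norms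
  of the terms are exactly the weights required.\<close>

lemma real_analytic_on_majorized:
  assumes "f real_analytic_on U" "a \<in> U"
  obtains r K where "0 < r" "majorized a r K f"
proof -
  obtain c :: "nat \<Rightarrow> nat \<Rightarrow> complex" and r where r: "r > 0" and sums: "\<forall>z\<in>ball a r.
      ((\<lambda>(m, n). c m n * of_real (Re z - Re a) ^ m * of_real (Im z - Im a) ^ n) has_sum f z) UNIV"
    using bspec[OF assms(1)[unfolded real_analytic_on_def] assms(2)] by (elim exE conjE) (rule that)
  \<comment> \<open>Points of this square satisfy \<open>norm (z - a) \<le> 2 * s\<close>, which is
    less than \<open>r\<close>.\<close>
  define s where "s = r / 4"
  have s: "0 < s" using r by (simp add: s_def)
  have in_ball: "z \<in> ball a r" if "z \<in> sq_nbhd a s" for z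
  proof -
    have "norm (z - a) \<le> \<bar>Re (z - a)\<bar> + \<bar>Im (z - a)\<bar>" by (rule cmod_le)
    also have "\<dots> < r" using that r unfolding sq_nbhd_def s_def by simp
    finally show ?thesis by (simp add: dist_norm norm_minus_commute)
  qed
  have nat_sum: "((\<lambda>i. c (fst (prod_decode i)) (snd (prod_decode i)) * of_real (Re z - Re a) ^ fst (prod_decode i)
      * of_real (Im z - Im a) ^ snd (prod_decode i)) has_sum f z) UNIV"
    if "z \<in> sq_nbhd a s" for z
    using iffD2[OF has_sum_reindex_bij_betw[OF bij_prod_decode] bspec[OF sums in_ball[OF that]]]
    by (simp add: case_prod_beta)
  have corner: "a + Complex s s \<in> sq_nbhd a s"
    using s by (simp add: sq_nbhd_def)
  have "(\<lambda>i. norm (c (fst (prod_decode i)) (snd (prod_decode i))) * s ^ (fst (prod_decode i) + snd (prod_decode i)))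
      summable_on UNIV"
    using has_sum_imp_summable[OF nat_sum[OF corner]] s
    by (simp add: summable_on_iff_abs_summable_on_complex norm_mult norm_power power_add mult.assoc)
  then obtain S where "((\<lambda>i. norm (c (fst (prod_decode i)) (snd (prod_decode i))) * s ^ (fst (prod_decode i) + snd (prod_decode i)))
      has_sum S) UNIV"
    by (auto simp: summable_on_def)
  from expansionI[OF this nat_sum] have "majorized a s S f"
    by (rule majorizedI) simp_all
  with s show thesis by (rule that)
qed

section \<open>Curves whose derivatives grow like \<open>(C n)\<^sup>n\<close>\<close>

text \<open>The quotient \<open>real n ^ n / fact n\<close> is a single term of the series of
  \<open>exp (real n)\<close>.\<close>

lemma of_nat_power_le_fact_exp: "real n ^ n \<le> exp (real n) * fact n"
proof -
  have "real n ^ n / fact n \<le> exp (real n)"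
  proof -
    have "(\<Sum>k\<in>{n}. real n ^ k /\<^sub>R fact k) \<le> exp (real n)"
      unfolding exp_def by (rule sum_le_suminf[OF summable_exp_generic]) auto
    then show ?thesis by (simp add: divide_inverse mult.commute)
  qed
  then show ?thesis by (simp add: pos_divide_le_eq)
qed

text \<open>The Taylor polynomials at 0 vanish, and the remainder of order \<open>n\<close> is at
  most \<open>K * (C * exp 1 * \<bar>t\<bar>) ^ n\<close>.\<close>

lemma analytic_growth_flat_eventually_0:
  fixes D :: "nat \<Rightarrow> real \<Rightarrow> complex"
  assumes \<eta>: "0 < \<eta>"
    and deriv: "\<And>n t. \<bar>t\<bar> < \<eta> \<Longrightarrow> (D n has_vector_derivative D (Suc n) t) (at t)"
    and zero: "\<And>n. D n 0 = 0"
    and bound: "\<And>n t. 1 \<le> n \<Longrightarrow> \<bar>t\<bar> < \<eta> \<Longrightarrow> norm (D n t) \<le> K * (C * real n) ^ n"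
    and KC: "0 \<le> K" "0 \<le> C"
  shows "\<forall>\<^sub>F t in nhds 0. D 0 t = 0"
proof -
  \<comment> \<open>Chosen to make \<open>C * exp 1 * \<bar>t\<bar>\<close> at most 1/2;
    \<open>C + 1\<close> keeps the denominator positive when \<open>C = 0\<close>.\<close>
  define \<sigma> where "\<sigma> = min \<eta> (1 / (2 * exp 1 * (C + 1)))"
  have \<sigma>: "0 < \<sigma>" using \<eta> KC by (simp add: \<sigma>_def)
  \<comment> \<open>The Lagrange form of the remainder holds for real functions only, so
    \<open>\<phi>\<close> stands for \<open>Re\<close> and \<open>Im\<close>, each with its own
    intermediate point.\<close>
  have component: "\<phi> (D 0 t) = 0"
    if t: "\<bar>t\<bar> < \<sigma>" and \<phi>: "bounded_linear \<phi>" and le: "\<And>z. \<bar>\<phi> z\<bar> \<le> norm z" for t and \<phi> :: "complex \<Rightarrow> real"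
  proof -
    have t\<eta>: "\<bar>t\<bar> < \<eta>" using t by (simp add: \<sigma>_def)
    have d: "DERIV (\<lambda>t. \<phi> (D n t)) s :> \<phi> (D (Suc n) s)" if "\<bar>s\<bar> \<le> \<bar>t\<bar>" for n s
    proof -
      have "\<bar>s\<bar> < \<eta>" using that t\<eta> by linarith
      from bounded_linear.has_vector_derivative[OF \<phi> deriv[OF this]]
      show ?thesis by (simp add: has_real_derivative_iff_has_vector_derivative)
    qed
    have "\<bar>t\<bar> \<le> 1 / (2 * exp 1 * (C + 1))" using t by (simp add: \<sigma>_def)
    then have "\<bar>t\<bar> * (2 * exp 1 * (C + 1)) \<le> 1"
      using KC by (simp add: pos_le_divide_eq)
    moreover have "\<bar>t\<bar> * (2 * exp 1 * C) \<le> \<bar>t\<bar> * (2 * exp 1 * (C + 1))"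
      by (intro mult_left_mono) auto
    moreover have "\<bar>t\<bar> * (2 * exp 1 * C) = 2 * (C * exp 1 * \<bar>t\<bar>)" by simp
    ultimately have half: "C * exp 1 * \<bar>t\<bar> \<le> 1 / 2" by linarith
    have "\<bar>\<phi> (D 0 t)\<bar> \<le> K * (1 / 2) ^ n" if n: "1 \<le> n" for n
    proof -
      obtain s where s: "\<bar>s\<bar> \<le> \<bar>t\<bar>" and
        "\<phi> (D 0 t) = (\<Sum>m<n. \<phi> (D m 0) / fact m * t ^ m) + \<phi> (D n s) / fact n * t ^ n"
        using Maclaurin_bi_le[of "\<lambda>n t. \<phi> (D n t)" "\<lambda>t. \<phi> (D 0 t)" n t] d by blast
      then have eq: "\<phi> (D 0 t) = \<phi> (D n s) / fact n * t ^ n"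
        by (simp add: zero linear_simps(3)[OF \<phi>])
      have "\<bar>\<phi> (D n s)\<bar> \<le> K * (C * real n) ^ n"
        using le[of "D n s"] bound[OF n, of s] s t\<eta> by linarith
      also have "\<dots> = K * C ^ n * real n ^ n" by (simp add: power_mult_distrib)
      also have "\<dots> \<le> K * C ^ n * (exp (real n) * fact n)"
        using KC of_nat_power_le_fact_exp[of n] by (intro mult_left_mono) auto
      finally have "\<bar>\<phi> (D n s)\<bar> / fact n \<le> K * C ^ n * exp (real n)"
        by (simp add: pos_divide_le_eq mult.assoc)
      then have "\<bar>\<phi> (D 0 t)\<bar> \<le> K * C ^ n * exp (real n) * \<bar>t\<bar> ^ n"
        unfolding eq abs_mult power_abs by (intro mult_right_mono) auto
      also have "\<dots> = K * (C * exp 1 * \<bar>t\<bar>) ^ n"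
        by (simp add: power_mult_distrib exp_of_nat_mult[of n 1, simplified])
      also have "\<dots> \<le> K * (1 / 2) ^ n"
        using half KC by (intro mult_left_mono power_mono) auto
      finally show ?thesis .
    qed
    then have "\<forall>\<^sub>F n in sequentially. \<bar>\<phi> (D 0 t)\<bar> \<le> K * (1 / 2) ^ n"
      by (auto intro: eventually_sequentiallyI[of 1])
    moreover have "(\<lambda>n. K * (1 / 2) ^ n) \<longlonglongrightarrow> 0"
      by (auto intro!: tendsto_eq_intros LIMSEQ_realpow_zero)
    ultimately have "\<bar>\<phi> (D 0 t)\<bar> \<le> 0"
      using tendsto_lowerbound[OF _ _ sequentially_bot] by blast
    then show ?thesis by simp
  qed
  have "D 0 t = 0" if "\<bar>t\<bar> < \<sigma>" for t
    using component[OF that bounded_linear_Re abs_Re_le_cmod]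
      component[OF that bounded_linear_Im abs_Im_le_cmod] by (simp add: complex_eq_iff)
  then show ?thesis
    using \<sigma> by (auto simp: eventually_nhds_metric dist_real_def)
qed

section \<open>Taylor coefficients and the order of a curve\<close>

text \<open>The iterated derivative is identified on the whole interval, since differentiating once
  more needs it near the point and not only at 0.\<close>

lemma taylor_coeff_eq:
  assumes "0 < \<eta>" "\<And>n t. \<bar>t\<bar> < \<eta> \<Longrightarrow> (D n has_vector_derivative D (Suc n) t) (at t)"
  shows "taylor_coeff (D 0) n = D n 0 / fact n"
proof -
  have "((\<lambda>h t. vector_derivative h (at t)) ^^ n) (D 0) t = D n t" if "\<bar>t\<bar> < \<eta>" for t
    using that
  proof (induction n arbitrary: t)
    case (Suc n)
    have "(((\<lambda>h t. vector_derivative h (at t)) ^^ n) (D 0) has_vector_derivative D (Suc n) t) (at t)"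
      by (rule has_vector_derivative_transform_within_open[OF assms(2)[OF Suc.prems], of "{-\<eta><..<\<eta>}"])
        (use Suc in auto)
    then show ?case by (simp add: vector_derivative_at)
  qed simp
  then show ?thesis using assms(1) by (simp add: taylor_coeff_def)
qed

text \<open>A function that vanishes near 0 vanishes near every point close to 0, and so does its
  derivative.\<close>

lemma derivatives_eventually_0:
  assumes "0 < \<eta>" "\<And>n t. \<bar>t\<bar> < \<eta> \<Longrightarrow> (D n has_vector_derivative D (Suc n) t) (at t)"
    and "\<forall>\<^sub>F t in nhds 0. D 0 t = 0"
  shows "\<forall>\<^sub>F t in nhds (0 :: real). D n t = 0"
proof (induction n)
  case (Suc n)
  have small: "\<forall>\<^sub>F t in nhds 0. \<bar>t\<bar> < \<eta>"
    using assms(1) by (auto simp: eventually_nhds_metric dist_real_def)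
  have "\<forall>\<^sub>F t in nhds 0. \<forall>\<^sub>F s in nhds t. D n s = 0"
    using Suc by (simp add: eventually_eventually)
  with small show ?case
  proof eventually_elim
    case (elim t)
    then obtain S where S: "open S" "t \<in> S" "\<And>s. s \<in> S \<Longrightarrow> D n s = 0"
      by (auto simp: eventually_nhds)
    have "(D n has_vector_derivative 0) (at t)"
      by (rule has_vector_derivative_transform_within_open[OF has_vector_derivative_const S(1,2)])
        (simp add: S(3))
    with assms(2)[OF elim(1)] show ?case
      using vector_derivative_unique_at by blast
  qed
qed (rule assms(3))

text \<open>A nonzero derivative at 0 excludes local constancy; if all vanish, the growth bound
  forces it. Hence a flat non-constant curve cannot occur.\<close>

lemma curve_order_eq:
  fixes D :: "nat \<Rightarrow> real \<Rightarrow> complex"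
  assumes \<eta>: "0 < \<eta>"
    and deriv: "\<And>n t. \<bar>t\<bar> < \<eta> \<Longrightarrow> (D n has_vector_derivative D (Suc n) t) (at t)"
    and D0: "D 0 = (\<lambda>t. \<Sigma> t - \<Sigma> 0)"
    and bound: "\<And>n t. 1 \<le> n \<Longrightarrow> \<bar>t\<bar> < \<eta> \<Longrightarrow> norm (D n t) \<le> K * (C * real n) ^ n"
    and KC: "0 \<le> K" "0 \<le> C"
  shows "curve_order \<Sigma> =
    (if \<exists>n\<ge>1. D n 0 \<noteq> 0 then enat (LEAST n. n \<ge> 1 \<and> D n 0 \<noteq> 0) else \<infinity>)"
proof -
  have const: "(\<forall>\<^sub>F t in nhds 0. \<Sigma> t = \<Sigma> 0) \<longleftrightarrow> (\<forall>\<^sub>F t in nhds 0. D 0 t = 0)"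
    by (simp add: D0)
  have zero: "D 0 0 = 0" by (simp add: D0)
  show ?thesis
  proof (cases "\<exists>n\<ge>1. D n 0 \<noteq> 0")
    case True
    then have "\<not> (\<forall>\<^sub>F t in nhds 0. D 0 t = 0)"
      using derivatives_eventually_0[where D = D, OF \<eta> deriv] eventually_nhds_x_imp_x by blast
    \<comment> \<open>Subtracting \<open>\<Sigma> 0\<close> kills the coefficient with index 0,
      which is why the least index may be sought among \<open>n \<ge> 1\<close>.\<close>
    moreover have "taylor_coeff (\<lambda>t. \<Sigma> t - \<Sigma> 0) n \<noteq> 0 \<longleftrightarrow> n \<ge> 1 \<and> D n 0 \<noteq> 0" for n
      using taylor_coeff_eq[where D = D and n = n, OF \<eta> deriv] zero
      by (cases "n = 0") (auto simp: D0)
    ultimately show ?thesis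
      using True const by (simp add: curve_order_def)
  next
    case False
    then have "D n 0 = 0" for n
      using zero by (cases n) auto
    then have "\<forall>\<^sub>F t in nhds 0. D 0 t = 0"
      by (intro analytic_growth_flat_eventually_0[OF \<eta> deriv _ bound KC]) auto
    then show ?thesis
      using False const by (simp add: curve_order_def)
  qed
qed

section \<open>Growth of \<open>L\<^sub>n\<close>\<close>

text \<open>Passing from complex to real partial derivatives produces the factor
  \<open>\<i> / 2\<close>, the origin of the powers of \<open>2 * \<i>\<close> along the
  curve.\<close>

lemma det_rows_nabla:
  "det_rows (nabla G z) (nabla H z)
    = \<i> / 2 * (partial_x G z * partial_y H z - partial_y G z * partial_x H z)"
  by (simp add: det_rows_def nabla_def field_simps)

lemma majorized_jacobian:
  assumes "majorized a r K f" "0 < r"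
  obtains M where "majorized a (r / 2) M (\<lambda>z. of_real (jacobian f z))"
proof -
  have r: "r - r / 2 = r / 2" "0 \<le> r / 2" "r / 2 \<le> r" "0 < r / 2" using assms(2) by auto
  note p = majorized_partials(1,2)[OF assms(1) r(4) r(3), unfolded r(1)]
  let ?fx = "partial_x f" and ?fy = "partial_y f"
  \<comment> \<open>The Jacobian is the imaginary part of \<open>cnj (?fx z) * ?fy z\<close>; this
    form uses only operations that preserve majorization.\<close>
  have eq: "of_real (jacobian f z) = - (\<i> / 2) * (cnj (?fx z) * ?fy z - ?fx z * cnj (?fy z))" for z
    by (simp add: complex_eq_iff jacobian_def field_simps)
  show thesis
    by (rule that, subst eq)
      (rule majorized_cmult majorized_diff majorized_mult majorized_cnj p r)+
qed

text \<open>Each step multiplies the bound by exactly \<open>M / \<delta>\<close>: the two products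
  in the determinant are compensated by \<open>norm (\<i> / 2)\<close>. The partial derivatives of
  the Jacobian are merely restricted, never differentiated again.\<close>

lemma majorized_L:
  assumes f: "majorized a R K f"
    and J: "majorized a R M (partial_x (\<lambda>w. of_real (jacobian f w)))"
      "majorized a R M (partial_y (\<lambda>w. of_real (jacobian f w)))"
    and \<delta>: "0 < \<delta>"
  shows "real n * \<delta> \<le> R \<Longrightarrow> majorized a (R - real n * \<delta>) (K * (M / \<delta>) ^ n) (L f n)"
proof (induction n)
  case 0
  then show ?case using f by simp
next
  case (Suc n)
  define r where "r = R - real n * \<delta>"
  have r: "R - real (Suc n) * \<delta> = r - \<delta>" "\<delta> \<le> r" "r - \<delta> \<le> R" "0 \<le> r - \<delta>"
    using Suc.prems \<delta> unfolding r_def by (auto simp: algebra_simps)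
  have "majorized a r (K * (M / \<delta>) ^ n) (L f n)"
    using Suc \<delta> unfolding r_def by (simp add: algebra_simps)
  note p = majorized_partials(1,2)[OF this \<delta> r(2)]
  note j = J[THEN majorized_mono, OF r(3,4) order_refl]
  have "majorized a (r - \<delta>)
      (norm (\<i> / 2) * (K * (M / \<delta>) ^ n / \<delta> * M + K * (M / \<delta>) ^ n / \<delta> * M)) (L f (Suc n))"
    unfolding L.simps det_rows_nabla by (intro majorized_cmult majorized_diff majorized_mult p j r)
  moreover have "norm (\<i> / 2) * (K * (M / \<delta>) ^ n / \<delta> * M + K * (M / \<delta>) ^ n / \<delta> * M)
      = K * (M / \<delta>) ^ Suc n"
    by (simp add: norm_divide)
  ultimately show ?case unfolding r(1) by simp
qed

text \<open>Takes \<open>\<delta> = R / (2 * real n)\<close>, so that \<open>n\<close> steps use up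
  exactly \<open>R / 2\<close>. The case \<open>n = 0\<close> is separate because it admits no such
  step length.\<close>

lemma majorized_L_half:
  assumes f: "majorized a R K f"
    and J: "majorized a R M (partial_x (\<lambda>w. of_real (jacobian f w)))"
      "majorized a R M (partial_y (\<lambda>w. of_real (jacobian f w)))"
    and R: "0 < R"
  shows "majorized a (R / 2) (K * (2 * M / R * real n) ^ n) (L f n)"
proof (cases "n = 0")
  case True
  then show ?thesis using majorized_mono[OF f, of "R / 2" K] R by simp
next
  case False
  then have "0 < R / (2 * real n)" "real n * (R / (2 * real n)) = R / 2" using R by auto
  with majorized_L[OF f J, of "R / (2 * real n)" n] show ?thesis
    using R False by (simp add: field_simps)
qed

section \<open>The derivatives of the critical value curve\<close>

theorem corollaryA3:
  fixes f :: "complex \<Rightarrow> complex" and U :: "complex set" and a :: complex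
    and \<epsilon> :: real and \<Gamma> :: "real \<Rightarrow> complex"
  assumes "open U" and "a \<in> U"
    and "f real_analytic_on U"
    and "regular_critical_point f a"
    and "natural_parametrization f U a \<epsilon> \<Gamma>"
  shows "curve_order (f \<circ> \<Gamma>) =
           (if \<exists>n\<ge>1. L f n a \<noteq> 0 then enat (LEAST n. n \<ge> 1 \<and> L f n a \<noteq> 0) else \<infinity>)"
proof -
  define J where "J = (\<lambda>w. complex_of_real (jacobian f w))"
  obtain r K where r: "0 < r" and f: "majorized a r K f"
    using real_analytic_on_majorized[OF assms(3,2)] .
  obtain M where J: "majorized a (r / 2) M J"
    using majorized_jacobian[OF f r] unfolding J_def .
  \<comment> \<open>The Jacobian is majorized at radius \<open>r / 2\<close>; differentiating it
    with loss \<open>R\<close> leaves radius \<open>R\<close>.\<close>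
  define R where "R = r / 4"
  have R: "0 < R" "R \<le> r / 2" "r / 2 - R = R" using r by (auto simp: R_def)
  define N where "N = M / R"
  note pJ = majorized_partials[OF J R(1,2), unfolded R(3), folded N_def]
  have fR: "majorized a R K f"
    using majorized_mono[OF f] R by simp
  have a: "a \<in> sq_nbhd a R" using R by (simp add: sq_nbhd_def)
  have K: "0 \<le> K" using majorized_bound[OF fR a] norm_ge_zero order_trans by blast
  have N: "0 \<le> N" using majorized_bound[OF pJ(1) a] norm_ge_zero order_trans by blast
  note L_maj = majorized_L_half[OF fR pJ(1,2)[unfolded J_def] R(1)]
  \<comment> \<open>Every \<open>L f n\<close> is majorized at radius \<open>R / 2\<close>.
    Differentiating it once more with loss \<open>\<rho>\<close> leaves \<open>\<rho>\<close>, the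
    square in which the curve has to stay.\<close>
  define \<rho> where "\<rho> = R / 4"
  have \<rho>: "0 < \<rho>" "\<rho> \<le> R / 2" "\<rho> \<le> R" "R / 2 - \<rho> = \<rho>" using R by (auto simp: \<rho>_def)
  \<comment> \<open>The determinants use the complex-valued Jacobian, the differential equation of
    \<open>\<Gamma>\<close> the real-valued one. Both are differentiable here, so their partial
    derivatives agree.\<close>
  have real_J: "partial_x J z = of_real (partial_x (jacobian f) z)"
    "partial_y J z = of_real (partial_y (jacobian f) z)" if z: "z \<in> sq_nbhd a R" for z
  proof -
    have "((\<lambda>w. Re (J w)) has_derivative (\<lambda>h. Re (Re h *\<^sub>R partial_x J z + Im h *\<^sub>R partial_y J z))) (at z)"
      by (rule has_derivative_Re[OF pJ(3)[OF z]])
    then have jac: "(jacobian f has_derivative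
        (\<lambda>h. Re h *\<^sub>R Re (partial_x J z) + Im h *\<^sub>R Re (partial_y J z))) (at z)"
      by (simp add: J_def)
    have "(J has_derivative (\<lambda>h. complex_of_real
        (Re h *\<^sub>R Re (partial_x J z) + Im h *\<^sub>R Re (partial_y J z)))) (at z)"
      unfolding J_def by (rule has_derivative_of_real[OF jac[unfolded J_def]])
    then have "(J has_derivative (\<lambda>h. Re h *\<^sub>R complex_of_real (Re (partial_x J z))
        + Im h *\<^sub>R complex_of_real (Re (partial_y J z)))) (at z)"
      by (simp add: scaleR_conv_of_real)
    from partial_derivatives_of_has_derivative[OF this] partial_derivatives_of_has_derivative[OF jac]
    show "partial_x J z = of_real (partial_x (jacobian f) z)"
      "partial_y J z = of_real (partial_y (jacobian f) z)"
      by simp_all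
  qed
  have \<epsilon>: "0 < \<epsilon>" and \<Gamma>0: "\<Gamma> 0 = a" and
    \<Gamma>': "\<And>t. \<bar>t\<bar> < \<epsilon> \<Longrightarrow> (\<Gamma> has_vector_derivative
        Complex (- partial_y (jacobian f) (\<Gamma> t)) (partial_x (jacobian f) (\<Gamma> t))) (at t)"
    using assms(5) by (auto simp: natural_parametrization_def abs_less_iff)
  have "isCont \<Gamma> 0"
    using \<Gamma>'[of 0] \<epsilon> by (auto intro: has_vector_derivative_continuous)
  then obtain d where d: "0 < d" "\<And>t. \<bar>t\<bar> < d \<Longrightarrow> dist (\<Gamma> t) a < \<rho>"
    using \<rho>(1) \<Gamma>0 by (auto simp: continuous_at_eps_delta dist_real_def)
  define \<eta> where "\<eta> = min \<epsilon> d"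
  have \<eta>: "0 < \<eta>" using \<epsilon> d by (simp add: \<eta>_def)
  have near: "\<Gamma> t \<in> sq_nbhd a \<rho>" if "\<bar>t\<bar> < \<eta>" for t
    using d(2)[of t] that abs_Re_le_cmod[of "\<Gamma> t - a"] abs_Im_le_cmod[of "\<Gamma> t - a"]
    by (simp add: \<eta>_def sq_nbhd_def dist_norm)
  \<comment> \<open>These are the successive derivatives of the curve shifted to vanish at 0; the
    shift affects only index 0.\<close>
  define D where "D = (\<lambda>n t. (2 * \<i>) ^ n * L f n (\<Gamma> t) - (if n = 0 then f a else 0))"
  have deriv: "(D n has_vector_derivative D (Suc n) t) (at t)" if t: "\<bar>t\<bar> < \<eta>" for n t
  proof -
    let ?z = "\<Gamma> t" and ?G = "L f n"
    let ?\<Gamma>' = "Complex (- partial_y (jacobian f) ?z) (partial_x (jacobian f) ?z)"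
    have zR: "?z \<in> sq_nbhd a R" using near[OF t] sq_nbhd_mono[OF \<rho>(3)] by blast
    have G: "(?G has_derivative (\<lambda>h. Re h *\<^sub>R partial_x ?G ?z + Im h *\<^sub>R partial_y ?G ?z)) (at ?z)"
      using majorized_partials(3)[OF L_maj \<rho>(1,2)] near[OF t] \<rho>(4) by simp
    have "(\<Gamma> has_vector_derivative ?\<Gamma>') (at t)"
      using \<Gamma>' t by (simp add: \<eta>_def)
    from vector_derivative_diff_chain_within[OF this has_derivative_at_withinI[OF G]]
    have "((\<lambda>t. ?G (\<Gamma> t)) has_vector_derivative
        (Re ?\<Gamma>' *\<^sub>R partial_x ?G ?z + Im ?\<Gamma>' *\<^sub>R partial_y ?G ?z)) (at t)"
      by (simp add: o_def)
    \<comment> \<open>Since the curve has velocity \<open>(-J_y, J_x)\<close>, the chain rule yields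
      the determinant of the gradients of \<open>?G\<close> and \<open>J\<close>, up to the factor
      from \<open>det_rows_nabla\<close>.\<close>
    moreover have "Re ?\<Gamma>' *\<^sub>R partial_x ?G ?z + Im ?\<Gamma>' *\<^sub>R partial_y ?G ?z = 2 * \<i> * L f (Suc n) ?z"
      unfolding L.simps det_rows_nabla J_def[symmetric] real_J[OF zR]
      by (simp add: scaleR_conv_of_real algebra_simps)
    ultimately have "((\<lambda>t. ?G (\<Gamma> t)) has_vector_derivative 2 * \<i> * L f (Suc n) ?z) (at t)"
      by simp
    from has_vector_derivative_diff[OF
        has_vector_derivative_mult_right[OF this, of "(2 * \<i>) ^ n"] has_vector_derivative_const]
    show ?thesis
      by (simp add: D_def mult.assoc mult.left_commute)
  qed
  have bound: "norm (D n t) \<le> K * (4 * N / R * real n) ^ n" if "1 \<le> n" "\<bar>t\<bar> < \<eta>" for n t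
  proof -
    have "\<Gamma> t \<in> sq_nbhd a (R / 2)" using near[OF that(2)] sq_nbhd_mono[OF \<rho>(2)] by blast
    from majorized_bound[OF L_maj this]
    have "2 ^ n * norm (L f n (\<Gamma> t)) \<le> 2 ^ n * (K * (2 * N / R * real n) ^ n)"
      by (rule mult_left_mono) simp
    \<comment> \<open>The norm \<open>2 ^ n\<close> of \<open>(2 * \<i>) ^ n\<close> is absorbed by
      doubling the growth constant.\<close>
    also have "\<dots> = K * (2 * (2 * N / R * real n)) ^ n"
      unfolding power_mult_distrib[of 2 "2 * N / R * real n"] by simp
    finally show ?thesis
      using that(1) by (simp add: D_def norm_mult norm_power mult.assoc)
  qed
  have D0: "D 0 = (\<lambda>t. (f \<circ> \<Gamma>) t - (f \<circ> \<Gamma>) 0)"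
    by (simp add: D_def \<Gamma>0)
  have "D n 0 \<noteq> 0 \<longleftrightarrow> L f n a \<noteq> 0" if "n \<ge> 1" for n
    using that by (simp add: D_def \<Gamma>0)
  then have L: "(\<exists>n\<ge>1. D n 0 \<noteq> 0) \<longleftrightarrow> (\<exists>n\<ge>1. L f n a \<noteq> 0)"
    "(\<lambda>n. n \<ge> 1 \<and> D n 0 \<noteq> 0) = (\<lambda>n. n \<ge> 1 \<and> L f n a \<noteq> 0)"
    by auto
  have "0 \<le> 4 * N / R" using N R by simp
  from curve_order_eq[OF \<eta> deriv D0 bound K this] show ?thesis
    unfolding L .
qed

end
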